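(* Let $A_1,\dots,A_k$ be abelian groups and let $X$ be the product nilspace $\prod_{i=1}^k\mathcal D_i(A_i)$. Then for each $s\in[k]$, the map sending a tuple $(T_s,T_{s+1},\dots,T_k)\in\prod_{i=s}^k\hom\big(\prod_{j=1}^{i-s}\mathcal D_j(A_j),\mathcal D_{i-s}(A_i)\big)$ to the map $\alpha:X\to X$, $$\alpha(x_1,\dots,x_k)=(x_1,\dots,x_k)+\big(0,\dots,0,T_s,T_{s+1}(x_1),\dots,T_k(x_1,\dots,x_{k-s})\big),$$ is a bijection onto the group $\Theta_s(X)$ of translations of height $s$ of $X$. (Here $T_s$ is an element of $A_s$, and the first $s-1$ coordinates of the added vector are $0$.)
   Context: Nilspaces: $\{0,1\}^n$ discrete cube, $|v|=\sum_jv_j$; discrete-cube morphisms $\{0,1\}^m\to\{0,1\}^n$ have coordinate functions $v\mapsto0,1,v_j,1-v_j$; a face of codimension $i$ fixes $i$ coordinates. A nilspace is a set $X$ with sets $C^n(X)\subseteq X^{\{0,1\}^n}$ of $n$-cubes closed under composition with discrete-cube morphisms, $C^1(X)=X^{\{0,1\}}$, and every $n$-corner extends to a cube. Morphisms send cubes to cubes; $\hom(X,Y)$ is the set of morphisms. Products of nilspaces have coordinatewise cubes; the empty product is a one-point nilspace. For an abelian group $A$ and $t\ge1$, $\mathcal D_t(A)$ is $A$ with $n$-cubes the maps $c$ with $\sum_{v\in\{0,1\}^{t+1}}(-1)^{|v|}c(\phi(v))=0$ for all discrete-cube morphisms $\phi:\{0,1\}^{t+1}\to\{0,1\}^n$;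 $\mathcal D_0(A)$ has as $n$-cubes exactly the constant maps, so morphisms from a (nonempty) nilspace into $\mathcal D_0(A)$ are the constant maps (identified with elements of $A$). A translation of height $s$ is a map $\alpha:X\to X$ such that for all $n$, $c\in C^n(X)$ and faces $F$ of codimension $s$, the map equal to $\alpha\circ c$ on $F$ and $c$ off $F$ is in $C^n(X)$; these form the group $\Theta_s(X)$. *)

theory Defs
  imports "HOL-Algebra.FiniteProduct"
begin

definition discrete_cube :: "nat \<Rightarrow> (nat \<Rightarrow> nat) set" where
  "discrete_cube n = {1..n} \<rightarrow>\<^sub>E {0, 1}"

definition cube_weight :: "nat \<Rightarrow> (nat \<Rightarrow> nat) \<Rightarrow> nat" where
  "cube_weight n v = (\<Sum>j = 1..n. v j)"

definition cube_morphisms :: "nat \<Rightarrow> nat \<Rightarrow> ((nat \<Rightarrow> nat) \<Rightarrow> nat \<Rightarrow> nat) set" where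
  "cube_morphisms m n =
    {\<phi> \<in> discrete_cube m \<rightarrow>\<^sub>E discrete_cube n.
      \<forall>i\<in>{1..n}.
        (\<forall>v\<in>discrete_cube m. \<phi> v i = 0) \<or>
        (\<forall>v\<in>discrete_cube m. \<phi> v i = 1) \<or>
        (\<exists>j\<in>{1..m}. \<forall>v\<in>discrete_cube m. \<phi> v i = v j) \<or>
        (\<exists>j\<in>{1..m}. \<forall>v\<in>discrete_cube m. \<phi> v i = 1 - v j)}"

definition cube_faces :: "nat \<Rightarrow> nat \<Rightarrow> (nat \<Rightarrow> nat) set set" where
  "cube_faces n i =
    {{v \<in> discrete_cube n. \<forall>j\<in>J. v j = w j} | J w.
      J \<subseteq> {1..n} \<and> card J = i \<and> w \<in> discrete_cube n}"

text \<open>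
  The data underlying a nilspace: a set with its \<open>n\<close>-cubes. The notions below (morphisms,
  products, translations) refer to this data only. All maps between carriers are extensional,
  i.e. \<open>undefined\<close> outside their domain, so that equality of maps is equality on the domain.
\<close>

record 'a cubespace =
  points :: "'a set"
  cubes :: "nat \<Rightarrow> ((nat \<Rightarrow> nat) \<Rightarrow> 'a) set"

definition nilspace_hom :: "'a cubespace \<Rightarrow> 'b cubespace \<Rightarrow> ('a \<Rightarrow> 'b) set" where
  "nilspace_hom X Y =
    {f \<in> points X \<rightarrow>\<^sub>E points Y.
      \<forall>n. \<forall>c\<in>cubes X n. compose (discrete_cube n) f c \<in> cubes Y n}"

text \<open>For \<open>I = {}\<close> the only point is \<open>\<lambda>_. undefined\<close>: the one-point nilspace.\<close>

definition product_nilspace :: "'i set \<Rightarrow> ('i \<Rightarrow> 'a cubespace) \<Rightarrow> ('i \<Rightarrow> 'a) cubespace" where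
  "product_nilspace I X =
    \<lparr>points = (\<Pi>\<^sub>E i\<in>I. points (X i)),
     cubes = (\<lambda>n. {c \<in> discrete_cube n \<rightarrow>\<^sub>E (\<Pi>\<^sub>E i\<in>I. points (X i)).
                \<forall>i\<in>I. (\<lambda>v\<in>discrete_cube n. c v i) \<in> cubes (X i) n})\<rparr>"

text \<open>
  The nilspace \<open>\<D>\<^sub>t(A)\<close>. The abelian group \<open>A\<close> is written multiplicatively, so
  the alternating sum of the values of \<open>c\<close> along \<open>\<phi>\<close> becomes a finite product of
  \<open>\<plusminus>1\<close>-st powers.
\<close>

definition degree_nilspace :: "nat \<Rightarrow> ('a, 'b) monoid_scheme \<Rightarrow> 'a cubespace" where
  "degree_nilspace t A =
    \<lparr>points = carrier A,
     cubes = (\<lambda>n.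
       if t = 0 then {\<lambda>v\<in>discrete_cube n. a | a. a \<in> carrier A}
       else {c \<in> discrete_cube n \<rightarrow>\<^sub>E carrier A.
         \<forall>\<phi>\<in>cube_morphisms (t + 1) n.
           (\<Otimes>\<^bsub>A\<^esub>v\<in>discrete_cube (t + 1).
              c (\<phi> v) [^]\<^bsub>A\<^esub> ((- 1 :: int) ^ cube_weight (t + 1) v)) = \<one>\<^bsub>A\<^esub>})\<rparr>"

definition graded_nilspace :: "nat \<Rightarrow> (nat \<Rightarrow> ('a, 'b) monoid_scheme) \<Rightarrow> (nat \<Rightarrow> 'a) cubespace" where
  "graded_nilspace k A = product_nilspace {1..k} (\<lambda>i. degree_nilspace i (A i))"

definition height_translations :: "nat \<Rightarrow> 'a cubespace \<Rightarrow> ('a \<Rightarrow> 'a) set" where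
  "height_translations s X =
    {\<alpha> \<in> points X \<rightarrow>\<^sub>E points X.
      \<forall>n. \<forall>c\<in>cubes X n. \<forall>F\<in>cube_faces n s.
        (\<lambda>v\<in>discrete_cube n. if v \<in> F then \<alpha> (c v) else c v) \<in> cubes X n}"

end

(*
  Split the i-th coordinate of a height s translation as x_i + g_i(x). Cubes of D_i(A) form a group,
  so the translation property says that for every cube c and every face F of codimension s, the map
  equal to g_i o c on F and 0 elsewhere is a cube of D_i(A_i). A function supported on such a face is
  a cube of D_i exactly when it is a cube of D_{i-s} on the face, and vanishes if i < s. Hence g_i is
  a morphism into D_{i-s}(A_i). It depends only on the coordinates up to t = i - s: if x and y agree
  there, the map sending the top vertex of {0,1}^(t+1) to y and all others to x is a cube of X, and
  the alternating sum of its image under g_i is +-(g_i(y) - g_i(x)).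
*)

theory Submission
  imports Defs
begin

text \<open>Every statement about degrees rests on one recursion: splitting a cube along an input
  coordinate turns an alternating product into a quotient of two products of one dimension less. An
  output coordinate of a discrete-cube morphism depends on at most one input coordinate, so for a
  suitable split a condition \<open>v j = b\<close> is constant on each half. Passing between a
  function and its cut-off to a face is therefore done one fixed coordinate at a time, each worth
  one degree. Cutting off shows that the maps of the theorem are translations; undoing the cut-off
  recovers the morphisms from a translation. A displacement is a priori a function of all
  \<open>k\<close> coordinates. The candidate for \<open>T i\<close> is obtained by filling the
  coordinates above \<open>i - s\<close> with identity elements, and independence of these
  coordinates makes that choice harmless. The case \<open>i = s\<close> is separate: the cubes of
  D_0 are constant by decree, which is met because the product of no factors has a single
  point.\<close>

section \<open>The discrete cube and its morphisms\<close>

text \<open>Placing \<open>b\<close> in slot \<open>l\<close> and moving the displaced entry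
  \<open>v l\<close> to the last slot avoids shifting indices. The order of the remaining
  coordinates is irrelevant for weights, and hence for alternating products.\<close>

definition insert_coord :: "nat \<Rightarrow> nat \<Rightarrow> nat \<Rightarrow> (nat \<Rightarrow> nat) \<Rightarrow> nat \<Rightarrow> nat" where
  "insert_coord m l b v = (\<lambda>i\<in>{1..Suc m}. if i = l then b else v (if i = Suc m then l else i))"

lemma finite_discrete_cube [simp]: "finite (discrete_cube n)"
  by (simp add: discrete_cube_def finite_PiE)

lemma discrete_cube_coord: "v \<in> discrete_cube n \<Longrightarrow> i \<in> {1..n} \<Longrightarrow> v i = 0 \<or> v i = 1"
  by (auto simp: discrete_cube_def PiE_def Pi_def)

lemma discrete_cube_eqI:
  "v \<in> discrete_cube n \<Longrightarrow> w \<in> discrete_cube n \<Longrightarrow> (\<And>i. i \<in> {1..n} \<Longrightarrow> v i = w i) \<Longrightarrow> v = w"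
  unfolding discrete_cube_def by (rule PiE_ext)

lemma restrict_in_discrete_cube:
  "(\<And>i. i \<in> {1..n} \<Longrightarrow> f i = 0 \<or> f i = 1) \<Longrightarrow> (\<lambda>i\<in>{1..n}. f i) \<in> discrete_cube n"
  by (auto simp: discrete_cube_def)

lemma insert_coord_in_cube:
  assumes "v \<in> discrete_cube m" "l \<in> {1..Suc m}" "b = 0 \<or> b = 1"
  shows "insert_coord m l b v \<in> discrete_cube (Suc m)"
  unfolding insert_coord_def
proof (rule restrict_in_discrete_cube)
  fix i assume i: "i \<in> {1..Suc m}"
  show "(if i = l then b else v (if i = Suc m then l else i)) = 0 \<or>
        (if i = l then b else v (if i = Suc m then l else i)) = 1"
    using assms i discrete_cube_coord[OF assms(1), of "if i = Suc m then l else i"] by auto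
qed

lemma inj_on_insert_coord:
  assumes "l \<in> {1..Suc m}"
  shows "inj_on (insert_coord m l b) (discrete_cube m)"
proof (rule inj_onI)
  fix v w assume v: "v \<in> discrete_cube m" and w: "w \<in> discrete_cube m"
    and eq: "insert_coord m l b v = insert_coord m l b w"
  show "v = w"
  proof (rule discrete_cube_eqI[OF v w])
    fix i assume i: "i \<in> {1..m}"
    show "v i = w i"
      using fun_cong[OF eq, of "if i = l then Suc m else i"] i
      by (auto simp: insert_coord_def split: if_splits)
  qed
qed

lemma insert_coord_decomp:
  assumes "l \<in> {1..Suc m}" "u \<in> discrete_cube (Suc m)"
  shows "\<exists>v\<in>discrete_cube m. u = insert_coord m l (u l) v"
proof -
  \<comment> \<open>The entry of \<open>u\<close> in the last slot returns to slot \<open>l\<close>,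
    from which \<open>insert_coord\<close> displaces it.\<close>
  define v where "v = (\<lambda>i\<in>{1..m}. u (if i = l then Suc m else i))"
  have v: "v \<in> discrete_cube m"
    unfolding v_def using discrete_cube_coord[OF assms(2)]
    by (intro restrict_in_discrete_cube) auto
  have "u = insert_coord m l (u l) v"
  proof (rule discrete_cube_eqI[OF assms(2)])
    show "insert_coord m l (u l) v \<in> discrete_cube (Suc m)"
      using insert_coord_in_cube[OF v assms(1)] discrete_cube_coord[OF assms(2,1)] by blast
  qed (use assms(1) in \<open>auto simp: insert_coord_def v_def\<close>)
  with v show ?thesis by blast
qed

lemma discrete_cube_Suc:
  assumes "l \<in> {1..Suc m}"
  shows "discrete_cube (Suc m) =
    insert_coord m l 0 ` discrete_cube m \<union> insert_coord m l 1 ` discrete_cube m"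
proof (intro equalityI subsetI)
  fix u assume u: "u \<in> discrete_cube (Suc m)"
  show "u \<in> insert_coord m l 0 ` discrete_cube m \<union> insert_coord m l 1 ` discrete_cube m"
    using insert_coord_decomp[OF assms u] discrete_cube_coord[OF u assms] by fastforce
qed (use insert_coord_in_cube assms in auto)

lemma insert_coord_images_disjoint:
  assumes "l \<in> {1..Suc m}"
  shows "insert_coord m l 0 ` discrete_cube m \<inter> insert_coord m l 1 ` discrete_cube m = {}"
proof -
  have "insert_coord m l b v l = b" for b v using assms by (simp add: insert_coord_def)
  then show ?thesis by (metis (no_types, lifting) disjoint_iff imageE zero_neq_one)
qed

lemma cube_weight_insert_coord:
  assumes "l \<in> {1..Suc m}"
  shows "cube_weight (Suc m) (insert_coord m l b v) = b + cube_weight m v"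
proof (cases "l = Suc m")
  case True
  then show ?thesis by (simp add: cube_weight_def insert_coord_def)
next
  case False
  then have l: "l \<in> {1..m}" using assms by auto
  have "cube_weight (Suc m) (insert_coord m l b v) = (\<Sum>i = 1..m. if i = l then b else v i) + v l"
    using False by (auto simp: cube_weight_def insert_coord_def intro!: sum.cong)
  also have "(\<Sum>i = 1..m. if i = l then b else v i) = b + (\<Sum>i\<in>{1..m} - {l}. v i)"
    using l by (subst sum.remove[of _ l]) auto
  also have "b + (\<Sum>i\<in>{1..m} - {l}. v i) + v l = b + cube_weight m v"
    unfolding cube_weight_def using l by (subst (2) sum.remove[of _ l]) auto
  finally show ?thesis .
qed

section \<open>Coordinate functions of discrete-cube morphisms\<close>

definition coord_function :: "nat \<Rightarrow> ((nat \<Rightarrow> nat) \<Rightarrow> nat) \<Rightarrow> bool" where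
  "coord_function m g \<longleftrightarrow>
    (\<forall>v\<in>discrete_cube m. g v = 0) \<or>
    (\<forall>v\<in>discrete_cube m. g v = 1) \<or>
    (\<exists>j\<in>{1..m}. \<forall>v\<in>discrete_cube m. g v = v j) \<or>
    (\<exists>j\<in>{1..m}. \<forall>v\<in>discrete_cube m. g v = 1 - v j)"

lemma cube_morphisms_iff:
  "\<phi> \<in> cube_morphisms m n \<longleftrightarrow>
    \<phi> \<in> discrete_cube m \<rightarrow>\<^sub>E discrete_cube n \<and> (\<forall>i\<in>{1..n}. coord_function m (\<lambda>v. \<phi> v i))"
  by (simp add: cube_morphisms_def coord_function_def)

lemma cube_morphism_in_cube:
  "\<phi> \<in> cube_morphisms m n \<Longrightarrow> v \<in> discrete_cube m \<Longrightarrow> \<phi> v \<in> discrete_cube n"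
  by (auto simp: cube_morphisms_iff)

lemma cube_morphism_coord:
  "\<phi> \<in> cube_morphisms m n \<Longrightarrow> i \<in> {1..n} \<Longrightarrow> coord_function m (\<lambda>v. \<phi> v i)"
  by (auto simp: cube_morphisms_iff)

lemma coord_function_bool:
  "coord_function m g \<Longrightarrow> v \<in> discrete_cube m \<Longrightarrow> g v = 0 \<or> g v = 1"
  unfolding coord_function_def using discrete_cube_coord[of v m] by fastforce

lemma coord_function_cong:
  assumes "coord_function m g" "\<And>v. v \<in> discrete_cube m \<Longrightarrow> g v = h v"
  shows "coord_function m h"
  using assms unfolding coord_function_def by simp

lemma coord_function_proj: "j \<in> {1..m} \<Longrightarrow> coord_function m (\<lambda>v. v j)"
  unfolding coord_function_def by blast

lemma coord_function_const: "b = 0 \<or> b = 1 \<Longrightarrow> coord_function m (\<lambda>v. b)"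
  unfolding coord_function_def by blast

lemma coord_function_flip:
  assumes "coord_function m g"
  shows "coord_function m (\<lambda>v. 1 - g v)"
  using assms[unfolded coord_function_def]
proof (elim disjE bexE)
  fix j assume j: "j \<in> {1..m}" and eq: "\<forall>v\<in>discrete_cube m. g v = 1 - v j"
  show ?thesis
    by (rule coord_function_cong[OF coord_function_proj[OF j]])
      (use eq discrete_cube_coord[OF _ j] in fastforce)
qed (auto simp: coord_function_def)

text \<open>The inner map is described by its values and coordinates instead of membership in
  \<open>cube_morphisms\<close>, so that it may be a map that is not extensional, such as
  \<open>\<lambda>u. restrict u {1..Suc t}\<close>.\<close>

lemma coord_function_comp:
  assumes g: "coord_function n g" and map: "\<And>v. v \<in> discrete_cube m \<Longrightarrow> \<phi> v \<in> discrete_cube n"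
    and \<phi>: "\<And>i. i \<in> {1..n} \<Longrightarrow> coord_function m (\<lambda>v. \<phi> v i)"
  shows "coord_function m (\<lambda>v. g (\<phi> v))"
  using g[unfolded coord_function_def]
proof (elim disjE bexE)
  fix j assume j: "j \<in> {1..n}" and eq: "\<forall>v\<in>discrete_cube n. g v = v j"
  show ?thesis by (rule coord_function_cong[OF \<phi>[OF j]]) (use map eq in auto)
next
  fix j assume j: "j \<in> {1..n}" and eq: "\<forall>v\<in>discrete_cube n. g v = 1 - v j"
  show ?thesis by (rule coord_function_cong[OF coord_function_flip[OF \<phi>[OF j]]]) (use map eq in auto)
qed (use map in \<open>auto simp: coord_function_def\<close>)

lemma cube_morphismI:
  assumes "\<And>v. v \<in> discrete_cube m \<Longrightarrow> \<phi> v \<in> discrete_cube n"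
    and "\<And>i. i \<in> {1..n} \<Longrightarrow> coord_function m (\<lambda>v. \<phi> v i)"
  shows "(\<lambda>v\<in>discrete_cube m. \<phi> v) \<in> cube_morphisms m n"
  unfolding cube_morphisms_iff
  using assms by (auto intro: coord_function_cong[OF assms(2)])

lemma cube_morphism_restrictI:
  assumes "\<And>i. i \<in> {1..n} \<Longrightarrow> coord_function m (\<lambda>v. f v i)"
  shows "(\<lambda>v\<in>discrete_cube m. \<lambda>i\<in>{1..n}. f v i) \<in> cube_morphisms m n"
proof (rule cube_morphismI)
  fix v assume v: "v \<in> discrete_cube m"
  show "(\<lambda>i\<in>{1..n}. f v i) \<in> discrete_cube n"
    using coord_function_bool[OF assms v] by (intro restrict_in_discrete_cube)
qed (simp add: assms)

lemma cube_morphism_comp: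
  assumes \<psi>: "\<psi> \<in> cube_morphisms m n" and \<phi>: "\<phi> \<in> cube_morphisms p m"
  shows "(\<lambda>v\<in>discrete_cube p. \<psi> (\<phi> v)) \<in> cube_morphisms p n"
  by (rule cube_morphismI)
    (auto intro: cube_morphism_in_cube[OF \<psi>] cube_morphism_in_cube[OF \<phi>]
      coord_function_comp[OF cube_morphism_coord[OF \<psi>]] cube_morphism_coord[OF \<phi>])

lemma cube_morphism_id: "(\<lambda>v\<in>discrete_cube n. v) \<in> cube_morphisms n n"
  by (rule cube_morphismI) (auto intro: coord_function_proj)

lemma coord_function_insert_coord:
  assumes "l \<in> {1..Suc m}" "b = 0 \<or> b = 1" "i \<in> {1..Suc m}"
  shows "coord_function m (\<lambda>v. insert_coord m l b v i)"
  using assms by (cases "i = l"; cases "i = Suc m")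
    (auto simp: insert_coord_def intro!: coord_function_proj coord_function_const)

lemma insert_coord_morphism:
  assumes "l \<in> {1..Suc m}" "b = 0 \<or> b = 1"
  shows "(\<lambda>v\<in>discrete_cube m. insert_coord m l b v) \<in> cube_morphisms m (Suc m)"
  using assms by (intro cube_morphismI insert_coord_in_cube coord_function_insert_coord)

text \<open>A coordinate function depends on at most one input; take \<open>l\<close> to be that
  input, or any input if the function is constant. A splitting along \<open>l\<close> then makes
  conditions on the value of \<open>g\<close> trivial or void on each half.\<close>

lemma coord_function_insert_coord_const:
  assumes "coord_function (Suc m) g"
  shows "\<exists>l\<in>{1..Suc m}. \<forall>b\<in>{0, 1}. \<exists>a. \<forall>v\<in>discrete_cube m. g (insert_coord m l b v) = a"
proof -
  have ins: "insert_coord m l b v \<in> discrete_cube (Suc m)" "insert_coord m l b v l = b"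
    if "l \<in> {1..Suc m}" "b = 0 \<or> b = 1" "v \<in> discrete_cube m" for l b v
    using that insert_coord_in_cube by (auto simp: insert_coord_def)
  from assms consider
      a where "\<forall>v\<in>discrete_cube (Suc m). g v = a"
    | j where "j \<in> {1..Suc m}" "\<forall>v\<in>discrete_cube (Suc m). g v = v j"
    | j where "j \<in> {1..Suc m}" "\<forall>v\<in>discrete_cube (Suc m). g v = 1 - v j"
    unfolding coord_function_def by blast
  then show ?thesis
  proof cases
    case 1
    show ?thesis by (rule bexI[of _ 1]) (use 1 ins in auto)
  next
    case (2 j)
    show ?thesis by (rule bexI[of _ j]) (use 2 ins in auto)
  next
    case (3 j)
    show ?thesis by (rule bexI[of _ j]) (use 3 ins in auto)
  qed
qed

text \<open>Pigeonhole: each of the \<open>n\<close> output coordinates looks at no more than one of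
  the \<open>Suc m > n\<close> input coordinates, so some input is ignored by all of them.\<close>

lemma cube_morphism_unused_coord:
  assumes \<phi>: "\<phi> \<in> cube_morphisms (Suc m) n" and "n \<le> m"
  shows "\<exists>l\<in>{1..Suc m}. \<forall>v\<in>discrete_cube m. \<phi> (insert_coord m l 0 v) = \<phi> (insert_coord m l 1 v)"
proof -
  \<comment> \<open>For a constant coordinate any index serves, so \<open>j\<close> is not confined
    to the input range; only the size of the set of chosen indices matters.\<close>
  have "\<exists>j. \<forall>u\<in>discrete_cube (Suc m). \<forall>w\<in>discrete_cube (Suc m). u j = w j \<longrightarrow> \<phi> u i = \<phi> w i"
    if "i \<in> {1..n}" for i
    using cube_morphism_coord[OF \<phi> that] unfolding coord_function_def
    by (elim disjE bexE) (auto, metis+)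
  then obtain J where J: "\<And>i u w. i \<in> {1..n} \<Longrightarrow> u \<in> discrete_cube (Suc m) \<Longrightarrow>
      w \<in> discrete_cube (Suc m) \<Longrightarrow> u (J i) = w (J i) \<Longrightarrow> \<phi> u i = \<phi> w i"
    by metis
  have "card (J ` {1..n}) < card {1..Suc m}"
    using card_image_le[of "{1..n}" J] \<open>n \<le> m\<close> by simp
  then have "\<not> {1..Suc m} \<subseteq> J ` {1..n}"
    by (meson card_mono finite_atLeastAtMost finite_imageI not_le)
  then obtain l where l: "l \<in> {1..Suc m}" "l \<notin> J ` {1..n}" by blast
  show ?thesis
  proof (intro bexI[OF _ l(1)] ballI)
    fix v assume v: "v \<in> discrete_cube m"
    have in_cube: "insert_coord m l b v \<in> discrete_cube (Suc m)" if "b = 0 \<or> b = 1" for b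
      using insert_coord_in_cube v l(1) that by blast
    show "\<phi> (insert_coord m l 0 v) = \<phi> (insert_coord m l 1 v)"
    proof (rule discrete_cube_eqI)
      fix i assume i: "i \<in> {1..n}"
      then have "J i \<noteq> l" using l(2) by auto
      then show "\<phi> (insert_coord m l 0 v) i = \<phi> (insert_coord m l 1 v) i"
        by (intro J[OF i] in_cube) (auto simp: insert_coord_def)
    qed (use cube_morphism_in_cube[OF \<phi>] in_cube in auto)
  qed
qed

section \<open>Alternating products and cubes of a given degree\<close>

definition altprod :: "('a, 'b) monoid_scheme \<Rightarrow> nat \<Rightarrow> ((nat \<Rightarrow> nat) \<Rightarrow> 'a) \<Rightarrow> 'a" where
  "altprod G m f = (\<Otimes>\<^bsub>G\<^esub>v\<in>discrete_cube m. f v [^]\<^bsub>G\<^esub> ((- 1 :: int) ^ cube_weight m v))"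

text \<open>For \<open>t = 0\<close> this says only that \<open>c\<close> is constant along edges, which suffices below.\<close>

definition degree_cube :: "('a, 'b) monoid_scheme \<Rightarrow> nat \<Rightarrow> nat \<Rightarrow> ((nat \<Rightarrow> nat) \<Rightarrow> 'a) \<Rightarrow> bool" where
  "degree_cube G t n c \<longleftrightarrow> (\<forall>v\<in>discrete_cube n. c v \<in> carrier G) \<and>
    (\<forall>\<phi>\<in>cube_morphisms (Suc t) n. altprod G (Suc t) (\<lambda>v. c (\<phi> v)) = \<one>\<^bsub>G\<^esub>)"

lemma degree_cube_carrier: "degree_cube G t n c \<Longrightarrow> v \<in> discrete_cube n \<Longrightarrow> c v \<in> carrier G"
  by (simp add: degree_cube_def)

lemma degree_cube_altprod:
  "degree_cube G t n c \<Longrightarrow> \<phi> \<in> cube_morphisms (Suc t) n \<Longrightarrow> altprod G (Suc t) (\<lambda>v. c (\<phi> v)) = \<one>\<^bsub>G\<^esub>"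
  by (simp add: degree_cube_def)

context comm_group
begin

lemma altprod_cong:
  assumes "\<And>v. v \<in> discrete_cube m \<Longrightarrow> f v = g v" "\<And>v. v \<in> discrete_cube m \<Longrightarrow> g v \<in> carrier G"
  shows "altprod G m f = altprod G m g"
  unfolding altprod_def by (rule finprod_cong') (use assms in auto)

lemma altprod_closed:
  "(\<And>v. v \<in> discrete_cube m \<Longrightarrow> f v \<in> carrier G) \<Longrightarrow> altprod G m f \<in> carrier G"
  unfolding altprod_def by (rule finprod_closed) auto

lemma altprod_one: "altprod G m (\<lambda>v. \<one>) = \<one>"
  unfolding altprod_def by (simp add: int_pow_one)

lemma altprod_mult:
  assumes "\<And>v. v \<in> discrete_cube m \<Longrightarrow> f v \<in> carrier G" "\<And>v. v \<in> discrete_cube m \<Longrightarrow> g v \<in> carrier G"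
  shows "altprod G m (\<lambda>v. f v \<otimes> g v) = altprod G m f \<otimes> altprod G m g"
proof -
  have "altprod G m (\<lambda>v. f v \<otimes> g v) = (\<Otimes>v\<in>discrete_cube m.
      f v [^] ((- 1 :: int) ^ cube_weight m v) \<otimes> g v [^] ((- 1 :: int) ^ cube_weight m v))"
    unfolding altprod_def by (rule finprod_cong') (use assms in \<open>auto simp: int_pow_mult_distrib m_comm\<close>)
  also have "\<dots> = altprod G m f \<otimes> altprod G m g"
    unfolding altprod_def by (rule finprod_multf) (use assms in auto)
  finally show ?thesis .
qed

lemma altprod_inv:
  assumes "\<And>v. v \<in> discrete_cube m \<Longrightarrow> f v \<in> carrier G"
  shows "altprod G m (\<lambda>v. inv (f v)) = inv (altprod G m f)"
proof -
  have "altprod G m (\<lambda>v. inv (f v)) \<otimes> altprod G m f = altprod G m (\<lambda>v. inv (f v) \<otimes> f v)"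
    using assms by (intro altprod_mult[symmetric]) auto
  also have "\<dots> = \<one>"
    using assms altprod_one[of m] altprod_cong[of m "\<lambda>v. inv (f v) \<otimes> f v" "\<lambda>v. \<one>"] by simp
  finally show ?thesis
    using assms by (intro inv_equality[symmetric] altprod_closed) auto
qed

text \<open>Vertices whose coordinate \<open>l\<close> is 1 have weight one larger than the vertex
  they come from, which flips every exponent on that half. All later sign bookkeeping goes through
  this recursion.\<close>

lemma altprod_Suc:
  assumes l: "l \<in> {1..Suc m}" and f: "\<And>v. v \<in> discrete_cube (Suc m) \<Longrightarrow> f v \<in> carrier G"
  shows "altprod G (Suc m) f =
    altprod G m (\<lambda>v. f (insert_coord m l 0 v)) \<otimes> inv (altprod G m (\<lambda>v. f (insert_coord m l 1 v)))"
proof -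
  let ?h = "\<lambda>v. f v [^] ((- 1 :: int) ^ cube_weight (Suc m) v)"
  have cl: "f (insert_coord m l b v) \<in> carrier G" if "b = 0 \<or> b = 1" "v \<in> discrete_cube m" for b v
    using that l by (intro f insert_coord_in_cube)
  have part: "finprod G ?h (insert_coord m l b ` discrete_cube m) =
      (\<Otimes>v\<in>discrete_cube m. ?h (insert_coord m l b v))" if "b = 0 \<or> b = 1" for b
    by (rule finprod_reindex) (use cl that inj_on_insert_coord[OF l] in auto)
  have "altprod G (Suc m) f = finprod G ?h (insert_coord m l 0 ` discrete_cube m) \<otimes>
      finprod G ?h (insert_coord m l 1 ` discrete_cube m)"
    unfolding altprod_def discrete_cube_Suc[OF l]
    by (rule finprod_Un_disjoint) (use insert_coord_images_disjoint[OF l] cl in auto)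
  also have "finprod G ?h (insert_coord m l 0 ` discrete_cube m) =
      altprod G m (\<lambda>v. f (insert_coord m l 0 v))"
    by (subst part) (simp_all add: altprod_def cube_weight_insert_coord[OF l])
  also have "finprod G ?h (insert_coord m l 1 ` discrete_cube m) =
      altprod G m (\<lambda>v. inv (f (insert_coord m l 1 v)))"
    unfolding altprod_def using cl
    by (subst part)
      (auto simp: cube_weight_insert_coord[OF l] int_pow_neg int_pow_inv intro!: finprod_cong')
  also have "\<dots> = inv (altprod G m (\<lambda>v. f (insert_coord m l 1 v)))"
    using cl by (intro altprod_inv) auto
  finally show ?thesis .
qed

text \<open>The two halves of the cube along coordinate \<open>l\<close> carry the same values with
  opposite signs and cancel.\<close>

lemma altprod_insert_coord_invariant:
  assumes l: "l \<in> {1..Suc m}" and f: "\<And>v. v \<in> discrete_cube (Suc m) \<Longrightarrow> f v \<in> carrier G"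
    and inv: "\<And>v. v \<in> discrete_cube m \<Longrightarrow> f (insert_coord m l 0 v) = f (insert_coord m l 1 v)"
  shows "altprod G (Suc m) f = \<one>"
proof -
  have cl: "f (insert_coord m l 1 v) \<in> carrier G" if "v \<in> discrete_cube m" for v
    using that l by (intro f insert_coord_in_cube) auto
  have "altprod G m (\<lambda>v. f (insert_coord m l 0 v)) = altprod G m (\<lambda>v. f (insert_coord m l 1 v))"
    using inv cl by (rule altprod_cong)
  then show ?thesis
    using cl altprod_closed[of m "\<lambda>v. f (insert_coord m l 1 v)"] altprod_Suc[OF l f] by simp
qed

lemma altprod_const:
  assumes "a \<in> carrier G"
  shows "altprod G (Suc m) (\<lambda>v. a) = \<one>"
  by (rule altprod_insert_coord_invariant[of 1]) (use assms in auto)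

text \<open>Only the all-ones vertex contributes, so the product is \<open>a\<close> or its inverse,
  depending on the parity of \<open>m\<close>.\<close>

lemma altprod_top_vertex:
  assumes a: "a \<in> carrier G" and eq: "altprod G m (\<lambda>v. if \<forall>j\<in>{1..m}. v j = 1 then a else \<one>) = \<one>"
  shows "a = \<one>"
proof -
  let ?u = "\<lambda>j\<in>{1..m}. 1 :: nat"
  let ?e = "(- 1 :: int) ^ cube_weight m ?u"
  have u: "?u \<in> discrete_cube m" by (rule restrict_in_discrete_cube) simp
  have top: "(\<forall>j\<in>{1..m}. v j = 1) \<longleftrightarrow> v = ?u" if "v \<in> discrete_cube m" for v
    using discrete_cube_eqI[OF that u] by auto
  have "altprod G m (\<lambda>v. if \<forall>j\<in>{1..m}. v j = 1 then a else \<one>) =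
      (\<Otimes>v\<in>discrete_cube m. if ?u = v then a [^] ?e else \<one>)"
    unfolding altprod_def by (rule finprod_cong') (use a top in \<open>auto simp: int_pow_one\<close>)
  also have "\<dots> = a [^] ?e"
    by (rule finprod_singleton[OF u, of "\<lambda>v. a [^] ?e"]) (use a in auto)
  finally have "a [^] ?e = \<one>" using eq by simp
  moreover have "?e = 1 \<or> ?e = - 1" by (simp only: minus_one_power_iff) simp
  ultimately have "a [^] (1 :: int) = \<one> \<or> a [^] (- 1 :: int) = \<one>" by (elim disjE) simp_all
  then show ?thesis using a by (simp add: int_pow_neg int_pow_1)
qed

section \<open>Cubes of a fixed degree and the degree filtration\<close>

lemma degree_cube_cong:
  assumes "degree_cube G t n c" "\<And>v. v \<in> discrete_cube n \<Longrightarrow> c v = d v"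
  shows "degree_cube G t n d"
proof -
  have "altprod G (Suc t) (\<lambda>v. d (\<phi> v)) = \<one>" if \<phi>: "\<phi> \<in> cube_morphisms (Suc t) n" for \<phi>
  proof -
    have "altprod G (Suc t) (\<lambda>v. d (\<phi> v)) = altprod G (Suc t) (\<lambda>v. c (\<phi> v))"
      using cube_morphism_in_cube[OF \<phi>] assms(2) degree_cube_carrier[OF assms(1)]
      by (intro altprod_cong) auto
    then show ?thesis using degree_cube_altprod[OF assms(1) \<phi>] by simp
  qed
  then show ?thesis using assms unfolding degree_cube_def by auto
qed

lemma degree_cube_const: "a \<in> carrier G \<Longrightarrow> degree_cube G t n (\<lambda>v. a)"
  by (simp add: degree_cube_def altprod_const)

lemma degree_cube_mult:
  assumes "degree_cube G t n c" "degree_cube G t n d"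
  shows "degree_cube G t n (\<lambda>v. c v \<otimes> d v)"
  using assms cube_morphism_in_cube unfolding degree_cube_def
  by (auto simp: altprod_mult)

lemma degree_cube_inv:
  assumes "degree_cube G t n c"
  shows "degree_cube G t n (\<lambda>v. inv (c v))"
  using assms cube_morphism_in_cube unfolding degree_cube_def
  by (auto simp: altprod_inv)

lemma degree_cube_altprod_comp:
  assumes c: "degree_cube G t n c" and \<phi>: "\<phi> \<in> cube_morphisms m n" and \<psi>: "\<psi> \<in> cube_morphisms (Suc t) m"
  shows "altprod G (Suc t) (\<lambda>v. c (\<phi> (\<psi> v))) = \<one>"
proof -
  have "altprod G (Suc t) (\<lambda>v. c ((\<lambda>v\<in>discrete_cube (Suc t). \<phi> (\<psi> v)) v)) = \<one>"
    using c cube_morphism_comp[OF \<phi> \<psi>] by (rule degree_cube_altprod)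
  moreover have "altprod G (Suc t) (\<lambda>v. c (\<phi> (\<psi> v))) =
      altprod G (Suc t) (\<lambda>v. c ((\<lambda>v\<in>discrete_cube (Suc t). \<phi> (\<psi> v)) v))"
    using degree_cube_carrier[OF c] cube_morphism_in_cube[OF \<phi>] cube_morphism_in_cube[OF \<psi>]
    by (intro altprod_cong) auto
  ultimately show ?thesis by simp
qed

lemma degree_cube_comp:
  assumes c: "degree_cube G t n c" and \<phi>: "\<phi> \<in> cube_morphisms m n"
  shows "degree_cube G t m (\<lambda>v. c (\<phi> v))"
  using degree_cube_altprod_comp[OF assms] degree_cube_carrier[OF c] cube_morphism_in_cube[OF \<phi>]
  unfolding degree_cube_def by auto

text \<open>Each half of a cube of dimension \<open>t + 2\<close> is parametrised by a cube of
  dimension \<open>t + 1\<close>, and the resulting composite is again a test morphism for degree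
  \<open>t\<close>. With \<open>altprod_Suc\<close> this raises degrees by one.\<close>

lemma altprod_insert_coord:
  assumes c: "degree_cube G t n c" and \<phi>: "\<phi> \<in> cube_morphisms (Suc (Suc t)) n"
    and l: "l \<in> {1..Suc (Suc t)}" "b = 0 \<or> b = 1"
  shows "altprod G (Suc t) (\<lambda>v. c (\<phi> (insert_coord (Suc t) l b v))) = \<one>"
proof -
  have "altprod G (Suc t) (\<lambda>v. c (\<phi> ((\<lambda>v\<in>discrete_cube (Suc t). insert_coord (Suc t) l b v) v))) = \<one>"
    using c \<phi> insert_coord_morphism[OF l] by (rule degree_cube_altprod_comp)
  moreover have "altprod G (Suc t) (\<lambda>v. c (\<phi> (insert_coord (Suc t) l b v))) =
     altprod G (Suc t) (\<lambda>v. c (\<phi> ((\<lambda>v\<in>discrete_cube (Suc t). insert_coord (Suc t) l b v) v)))"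
    using degree_cube_carrier[OF c] cube_morphism_in_cube[OF \<phi>] insert_coord_in_cube[OF _ l]
    by (intro altprod_cong) auto
  ultimately show ?thesis by simp
qed

text \<open>Both halves of an alternating product of dimension \<open>t + 2\<close> are already
  trivial in degree \<open>t\<close>.\<close>

lemma degree_cube_Suc:
  assumes c: "degree_cube G t n c"
  shows "degree_cube G (Suc t) n c"
  unfolding degree_cube_def
proof (intro conjI ballI)
  fix \<phi> assume \<phi>: "\<phi> \<in> cube_morphisms (Suc (Suc t)) n"
  show "altprod G (Suc (Suc t)) (\<lambda>v. c (\<phi> v)) = \<one>"
    using altprod_Suc[of 1 "Suc t" "\<lambda>v. c (\<phi> v)"] altprod_insert_coord[OF c \<phi>, of 1]
      degree_cube_carrier[OF c] cube_morphism_in_cube[OF \<phi>] by simp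
qed (rule degree_cube_carrier[OF c])

lemma degree_cube_mono:
  assumes "degree_cube G t n c" "t \<le> t'"
  shows "degree_cube G t' n c"
  using assms(2,1) by (induction rule: dec_induct) (auto intro: degree_cube_Suc)

text \<open>A test morphism starts from dimension \<open>t + 1 > n\<close> and hence ignores some
  input coordinate, along which the alternating product cancels.\<close>

lemma degree_cube_low_dim:
  assumes "n \<le> t" "\<And>v. v \<in> discrete_cube n \<Longrightarrow> c v \<in> carrier G"
  shows "degree_cube G t n c"
  unfolding degree_cube_def
proof (intro conjI ballI assms(2))
  fix \<phi> assume \<phi>: "\<phi> \<in> cube_morphisms (Suc t) n"
  obtain l where "l \<in> {1..Suc t}"
    "\<And>v. v \<in> discrete_cube t \<Longrightarrow> \<phi> (insert_coord t l 0 v) = \<phi> (insert_coord t l 1 v)"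
    using cube_morphism_unused_coord[OF \<phi> assms(1)] by blast
  then show "altprod G (Suc t) (\<lambda>v. c (\<phi> v)) = \<one>"
    using assms(2) cube_morphism_in_cube[OF \<phi>]
    by (intro altprod_insert_coord_invariant[of l]) auto
qed

section \<open>Functions supported on a face\<close>

text \<open>Along a discrete-cube morphism, the condition \<open>v j = b\<close> becomes trivial, void, or fixes one
  coordinate; each piece is then an alternating product of one dimension less.\<close>

lemma degree_cube_on_hyperplane:
  assumes c: "degree_cube G t n c" and j: "j \<in> {1..n}"
  shows "degree_cube G (Suc t) n (\<lambda>v. if v j = b then c v else \<one>)"
  unfolding degree_cube_def
proof (intro conjI ballI)
  fix \<phi> assume \<phi>: "\<phi> \<in> cube_morphisms (Suc (Suc t)) n"
  obtain l where l: "l \<in> {1..Suc (Suc t)}" and const: "\<forall>b'\<in>{0, 1}.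
      \<exists>a. \<forall>v\<in>discrete_cube (Suc t). \<phi> (insert_coord (Suc t) l b' v) j = a"
    using coord_function_insert_coord_const[OF cube_morphism_coord[OF \<phi> j]] by blast
  let ?f = "\<lambda>v. if \<phi> v j = b then c (\<phi> v) else \<one>"
  have f: "?f v \<in> carrier G" if "v \<in> discrete_cube (Suc (Suc t))" for v
    using degree_cube_carrier[OF c] cube_morphism_in_cube[OF \<phi> that] by auto
  have half: "altprod G (Suc t) (\<lambda>v. ?f (insert_coord (Suc t) l b' v)) = \<one>" if b': "b' = 0 \<or> b' = 1" for b'
  proof -
    obtain a where a: "\<And>v. v \<in> discrete_cube (Suc t) \<Longrightarrow> \<phi> (insert_coord (Suc t) l b' v) j = a"
      using const b' by blast
    have ins: "insert_coord (Suc t) l b' v \<in> discrete_cube (Suc (Suc t))"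
      if "v \<in> discrete_cube (Suc t)" for v using insert_coord_in_cube[OF that l b'] .
    show ?thesis
    proof (cases "a = b")
      case True
      have "altprod G (Suc t) (\<lambda>v. ?f (insert_coord (Suc t) l b' v)) =
          altprod G (Suc t) (\<lambda>v. c (\<phi> (insert_coord (Suc t) l b' v)))"
        using a True degree_cube_carrier[OF c] cube_morphism_in_cube[OF \<phi> ins]
        by (intro altprod_cong) auto
      then show ?thesis using altprod_insert_coord[OF c \<phi> l b'] by simp
    next
      case False
      have "altprod G (Suc t) (\<lambda>v. ?f (insert_coord (Suc t) l b' v)) = altprod G (Suc t) (\<lambda>v. \<one>)"
        using a False by (intro altprod_cong) auto
      then show ?thesis using altprod_one by simp
    qed
  qed
  have "altprod G (Suc (Suc t)) ?f =
      altprod G (Suc t) (\<lambda>v. ?f (insert_coord (Suc t) l 0 v)) \<otimes>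
      inv (altprod G (Suc t) (\<lambda>v. ?f (insert_coord (Suc t) l 1 v)))"
    using l f by (rule altprod_Suc)
  also have "\<dots> = \<one>"
    by (simp only: half simp_thms inv_one l_one one_closed)
  finally show "altprod G (Suc (Suc t)) ?f = \<one>" .
qed (use degree_cube_carrier[OF c] in auto)

text \<open>Each fixed coordinate costs one degree, by induction over \<open>J\<close> with
  \<open>degree_cube_on_hyperplane\<close>. This is the direction that makes shift maps
  translations.\<close>

lemma degree_cube_on_face:
  assumes "finite J" "J \<subseteq> {1..n}" and c: "degree_cube G t n c"
  shows "degree_cube G (t + card J) n (\<lambda>v. if \<forall>j\<in>J. v j = w j then c v else \<one>)"
  using assms(1,2)
proof (induction J)
  case empty
  then show ?case using c by simp
next
  case (insert j J)
  then have "degree_cube G (Suc (t + card J)) n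
      (\<lambda>v. if v j = w j then if \<forall>j\<in>J. v j = w j then c v else \<one> else \<one>)"
    by (intro degree_cube_on_hyperplane) auto
  then have "degree_cube G (Suc (t + card J)) n
      (\<lambda>v. if \<forall>j\<in>insert j J. v j = w j then c v else \<one>)"
    by (rule degree_cube_cong) auto
  then show ?case using insert by simp
qed

text \<open>A test morphism \<open>\<phi>\<close> for \<open>h\<close> is extended to a test
  morphism \<open>\<psi>\<close> by letting one further input drive the last output. In the
  alternating product along \<open>\<psi>\<close>, the half where this input is 0 is trivial, and
  the half where it is 1 is the product of \<open>h\<close> along \<open>\<phi>\<close>, so the
  latter is trivial too.\<close>

lemma degree_cube_from_hyperplane:
  assumes h: "\<And>v. v \<in> discrete_cube m \<Longrightarrow> h v \<in> carrier G"
    and d: "degree_cube G (Suc t) (Suc m) (\<lambda>v. if v (Suc m) = 1 then h (restrict v {1..m}) else \<one>)"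
  shows "degree_cube G t m h"
  unfolding degree_cube_def
proof (intro conjI ballI h)
  fix \<phi> assume \<phi>: "\<phi> \<in> cube_morphisms (Suc t) m"
  define \<psi> where "\<psi> = (\<lambda>u\<in>discrete_cube (Suc (Suc t)). \<lambda>i\<in>{1..Suc m}.
      if i = Suc m then u (Suc (Suc t)) else \<phi> (restrict u {1..Suc t}) i)"
  have restr: "restrict u {1..Suc t} \<in> discrete_cube (Suc t)" if "u \<in> discrete_cube (Suc (Suc t))" for u
    using discrete_cube_coord[OF that] by (intro restrict_in_discrete_cube) auto
  have \<psi>: "\<psi> \<in> cube_morphisms (Suc (Suc t)) (Suc m)"
    unfolding \<psi>_def
  proof (rule cube_morphism_restrictI)
    fix i assume i: "i \<in> {1..Suc m}"
    show "coord_function (Suc (Suc t)) (\<lambda>u. if i = Suc m then u (Suc (Suc t)) else \<phi> (restrict u {1..Suc t}) i)"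
    proof (cases "i = Suc m")
      case True
      then show ?thesis by (simp add: coord_function_proj)
    next
      case False
      then have "i \<in> {1..m}" using i by auto
      then have "coord_function (Suc (Suc t)) (\<lambda>u. \<phi> (restrict u {1..Suc t}) i)"
        by (intro coord_function_comp[OF cube_morphism_coord[OF \<phi>]] restr) (auto intro: coord_function_proj)
      then show ?thesis using False by simp
    qed
  qed
  let ?f = "\<lambda>u. if \<psi> u (Suc m) = 1 then h (restrict (\<psi> u) {1..m}) else \<one>"
  have ins: "insert_coord (Suc t) (Suc (Suc t)) b v \<in> discrete_cube (Suc (Suc t))"
      "restrict (insert_coord (Suc t) (Suc (Suc t)) b v) {1..Suc t} = v"
    if v: "v \<in> discrete_cube (Suc t)" and b: "b = 0 \<or> b = 1" for v b
  proof -
    show in_cube: "insert_coord (Suc t) (Suc (Suc t)) b v \<in> discrete_cube (Suc (Suc t))"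
      using insert_coord_in_cube[OF v _ b] by simp
    show "restrict (insert_coord (Suc t) (Suc (Suc t)) b v) {1..Suc t} = v"
      by (rule discrete_cube_eqI[OF restr[OF in_cube] v]) (simp add: insert_coord_def)
  qed
  have top: "\<psi> (insert_coord (Suc t) (Suc (Suc t)) b v) (Suc m) = b"
    and bot: "restrict (\<psi> (insert_coord (Suc t) (Suc (Suc t)) b v)) {1..m} = \<phi> v"
    if v: "v \<in> discrete_cube (Suc t)" and b: "b = 0 \<or> b = 1" for v b
  proof -
    show "\<psi> (insert_coord (Suc t) (Suc (Suc t)) b v) (Suc m) = b"
      using ins(1)[OF v b] by (simp add: \<psi>_def insert_coord_def)
    have "restrict (\<phi> v) {1..m} = \<phi> v"
      using cube_morphism_in_cube[OF \<phi> v] by (auto simp: discrete_cube_def PiE_restrict)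
    moreover have "restrict (\<psi> (insert_coord (Suc t) (Suc (Suc t)) b v)) {1..m} = restrict (\<phi> v) {1..m}"
      using ins[OF v b] by (intro restrict_ext) (simp add: \<psi>_def)
    ultimately show "restrict (\<psi> (insert_coord (Suc t) (Suc (Suc t)) b v)) {1..m} = \<phi> v" by simp
  qed
  have "altprod G (Suc (Suc t)) ?f = \<one>"
    using degree_cube_altprod[OF d \<psi>] by simp
  moreover have "?f u \<in> carrier G" if "u \<in> discrete_cube (Suc (Suc t))" for u
    using degree_cube_carrier[OF d cube_morphism_in_cube[OF \<psi> that]] by simp
  ultimately have "altprod G (Suc t) (\<lambda>v. ?f (insert_coord (Suc t) (Suc (Suc t)) 0 v)) \<otimes>
     inv (altprod G (Suc t) (\<lambda>v. ?f (insert_coord (Suc t) (Suc (Suc t)) 1 v))) = \<one>"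
    by (subst (asm) altprod_Suc[of "Suc (Suc t)"]) auto
  moreover have "altprod G (Suc t) (\<lambda>v. ?f (insert_coord (Suc t) (Suc (Suc t)) 0 v)) = \<one>"
    using top by (subst altprod_one[of "Suc t", symmetric], intro altprod_cong) auto
  moreover have "altprod G (Suc t) (\<lambda>v. ?f (insert_coord (Suc t) (Suc (Suc t)) 1 v)) =
      altprod G (Suc t) (\<lambda>v. h (\<phi> v))"
    using top bot h cube_morphism_in_cube[OF \<phi>] by (intro altprod_cong) auto
  moreover have "altprod G (Suc t) (\<lambda>v. h (\<phi> v)) \<in> carrier G"
    using h cube_morphism_in_cube[OF \<phi>] by (intro altprod_closed) auto
  ultimately show "altprod G (Suc t) (\<lambda>v. h (\<phi> v)) = \<one>"
    by (metis inv_closed inv_inv inv_one l_one)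
qed

text \<open>Partial converse of \<open>degree_cube_on_face\<close>. The \<open>s\<close> fixed
  coordinates are peeled off from the last one down, each lowering degree and dimension by one,
  while \<open>h\<close> sees only the first \<open>m\<close> coordinates throughout.\<close>

lemma degree_cube_from_face:
  assumes h: "\<And>v. v \<in> discrete_cube m \<Longrightarrow> h v \<in> carrier G"
    and "degree_cube G (t + s) (m + s)
      (\<lambda>v. if \<forall>j\<in>{m+1..m+s}. v j = 1 then h (restrict v {1..m}) else \<one>)"
  shows "degree_cube G t m h"
  using assms(2)
proof (induction s)
  case 0
  have "restrict v {1..m} = v" if "v \<in> discrete_cube m" for v
    using that by (auto simp: discrete_cube_def PiE_restrict)
  then show ?case using 0 by (auto intro: degree_cube_cong)
next
  case (Suc s)
  let ?h = "\<lambda>v. if \<forall>j\<in>{m+1..m+s}. v j = 1 then h (restrict v {1..m}) else \<one>"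
  have "degree_cube G (Suc (t + s)) (Suc (m + s))
     (\<lambda>v. if v (Suc (m + s)) = 1 then ?h (restrict v {1..m + s}) else \<one>)"
  proof (rule degree_cube_cong)
    show "degree_cube G (Suc (t + s)) (Suc (m + s))
      (\<lambda>v. if \<forall>j\<in>{m+1..m+Suc s}. v j = 1 then h (restrict v {1..m}) else \<one>)"
      using Suc.prems by simp
    fix v :: "nat \<Rightarrow> nat"
    have "{m+1..m+Suc s} = insert (Suc (m + s)) {m+1..m+s}" by auto
    moreover have "restrict (restrict v {1..m+s}) {1..m} = restrict v {1..m}"
      by (auto simp: restrict_def)
    ultimately show "(if \<forall>j\<in>{m+1..m+Suc s}. v j = 1 then h (restrict v {1..m}) else \<one>) =
       (if v (Suc (m + s)) = 1 then ?h (restrict v {1..m + s}) else \<one>)" by auto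
  qed
  moreover have "restrict v {1..m} \<in> discrete_cube m" if "v \<in> discrete_cube (m + s)" for v
    using discrete_cube_coord[OF that] by (intro restrict_in_discrete_cube) auto
  ultimately have "degree_cube G (t + s) (m + s) ?h"
    using h by (rule_tac degree_cube_from_hyperplane) auto
  then show ?case by (rule Suc.IH)
qed

text \<open>Dividing by the constant cube \<open>a\<close> leaves a function supported at the top
  vertex. In dimension \<open>Suc t\<close> the identity is itself a test morphism, and its
  alternating product has a single nontrivial factor.\<close>

lemma degree_cube_two_values:
  assumes ab: "a \<in> carrier G" "b \<in> carrier G"
    and d: "degree_cube G t (Suc t) (\<lambda>v. if \<forall>j\<in>{1..Suc t}. v j = 1 then b else a)"
  shows "a = b"
proof -
  let ?top = "\<lambda>v. \<forall>j\<in>{1..Suc t}. v j = (1 :: nat)"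
  have "degree_cube G t (Suc t) (\<lambda>v. inv a \<otimes> (if ?top v then b else a))"
    using degree_cube_const[of "inv a"] d ab by (intro degree_cube_mult) auto
  then have "degree_cube G t (Suc t) (\<lambda>v. if ?top v then inv a \<otimes> b else \<one>)"
    by (rule degree_cube_cong) (use ab in auto)
  from degree_cube_altprod[OF this cube_morphism_id]
  have "altprod G (Suc t) (\<lambda>v. if ?top ((\<lambda>v\<in>discrete_cube (Suc t). v) v) then inv a \<otimes> b else \<one>) = \<one>" .
  also have "altprod G (Suc t) (\<lambda>v. if ?top ((\<lambda>v\<in>discrete_cube (Suc t). v) v) then inv a \<otimes> b else \<one>) =
      altprod G (Suc t) (\<lambda>v. if ?top v then inv a \<otimes> b else \<one>)"
    using ab by (intro altprod_cong) auto
  finally have "inv a \<otimes> b = \<one>"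
    using ab by (rule_tac altprod_top_vertex[of _ "Suc t"]) auto
  then show ?thesis using ab by (metis inv_equality inv_inv inv_closed)
qed

section \<open>Comparison with the cubes of D_t(A)\<close>

lemma cubes_degree_nilspace:
  assumes "t > 0"
  shows "c \<in> cubes (degree_nilspace t G) n \<longleftrightarrow> c \<in> extensional (discrete_cube n) \<and> degree_cube G t n c"
  using assms by (auto simp: degree_nilspace_def degree_cube_def altprod_def PiE_def)

lemma cubes_degree_nilspace_imp_degree_cube:
  assumes "c \<in> cubes (degree_nilspace t G) n"
  shows "degree_cube G t n c"
proof (cases "t = 0")
  case True
  then obtain a where "a \<in> carrier G" "c = (\<lambda>v\<in>discrete_cube n. a)"
    using assms by (auto simp: degree_nilspace_def)
  then show ?thesis using degree_cube_cong[OF degree_cube_const] by auto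
qed (use assms cubes_degree_nilspace in auto)

lemma nilspace_hom_degree_cube:
  assumes "f \<in> nilspace_hom X (degree_nilspace t G)" "c \<in> cubes X n"
  shows "degree_cube G t n (\<lambda>v. f (c v))"
proof (rule degree_cube_cong)
  show "degree_cube G t n (compose (discrete_cube n) f c)"
    using assms by (intro cubes_degree_nilspace_imp_degree_cube) (simp add: nilspace_hom_def)
qed (simp add: compose_def)

end

section \<open>Translations of the graded nilspace\<close>

lemma points_degree_nilspace: "points (degree_nilspace t G) = carrier G"
  by (simp add: degree_nilspace_def)

lemma points_graded_nilspace: "points (graded_nilspace t A) = (\<Pi>\<^sub>E i\<in>{1..t}. carrier (A i))"
  by (simp add: graded_nilspace_def product_nilspace_def points_degree_nilspace)

lemma graded_point_coord:
  "x \<in> points (graded_nilspace t A) \<Longrightarrow> i \<in> {1..t} \<Longrightarrow> x i \<in> carrier (A i)"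
  by (auto simp: points_graded_nilspace)

lemma nilspace_hom_in_carrier:
  "f \<in> nilspace_hom X (degree_nilspace t G) \<Longrightarrow> x \<in> points X \<Longrightarrow> f x \<in> carrier G"
  by (auto simp: nilspace_hom_def points_degree_nilspace)

section \<open>Cubes of partial products, restriction and padding\<close>

locale graded_groups =
  fixes A :: "nat \<Rightarrow> ('a, 'b) monoid_scheme" and k :: nat
  assumes comm_groups: "i \<in> {1..k} \<Longrightarrow> comm_group (A i)"
begin

lemma group_one_closed: "i \<in> {1..k} \<Longrightarrow> \<one>\<^bsub>A i\<^esub> \<in> carrier (A i)"
  using comm_groups by (meson comm_group.axioms(2) group.is_monoid monoid.one_closed)

text \<open>Stated for all \<open>t \<le> k\<close> because it serves both the full product
  (\<open>t = k\<close>) and the domains of the morphisms \<open>T i\<close>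
  (\<open>t = i - s\<close>).\<close>

lemma cubes_graded_iff:
  assumes "t \<le> k"
  shows "c \<in> cubes (graded_nilspace t A) n \<longleftrightarrow>
    c \<in> discrete_cube n \<rightarrow>\<^sub>E points (graded_nilspace t A) \<and>
    (\<forall>i\<in>{1..t}. degree_cube (A i) i n (\<lambda>v. c v i))"
proof -
  have "(\<lambda>v\<in>discrete_cube n. c v i) \<in> cubes (degree_nilspace i (A i)) n \<longleftrightarrow>
      degree_cube (A i) i n (\<lambda>v. c v i)" if "i \<in> {1..t}" for i
  proof -
    interpret comm_group "A i" using comm_groups that assms by auto
    have "(\<lambda>v\<in>discrete_cube n. c v i) \<in> cubes (degree_nilspace i (A i)) n \<longleftrightarrow>
        degree_cube (A i) i n (\<lambda>v\<in>discrete_cube n. c v i)"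
      using cubes_degree_nilspace[of i] that by simp
    also have "\<dots> \<longleftrightarrow> degree_cube (A i) i n (\<lambda>v. c v i)"
      by (rule iffI; erule degree_cube_cong) simp_all
    finally show ?thesis .
  qed
  then show ?thesis
    by (simp add: graded_nilspace_def product_nilspace_def points_degree_nilspace)
qed

lemma cubes_graded_restrictI:
  assumes "t \<le> k" "\<And>i. i \<in> {1..t} \<Longrightarrow> degree_cube (A i) i n (\<lambda>v. f v i)"
  shows "(\<lambda>v\<in>discrete_cube n. \<lambda>i\<in>{1..t}. f v i) \<in> cubes (graded_nilspace t A) n"
  unfolding cubes_graded_iff[OF assms(1)] points_graded_nilspace
proof (intro conjI ballI)
  fix i assume i: "i \<in> {1..t}"
  then interpret comm_group "A i" using comm_groups assms(1) by auto
  show "degree_cube (A i) i n (\<lambda>v. (\<lambda>v\<in>discrete_cube n. \<lambda>i\<in>{1..t}. f v i) v i)"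
    by (rule degree_cube_cong[OF assms(2)[OF i]]) (use i in simp)
qed (use degree_cube_carrier[OF assms(2)] in auto)

lemma cubes_graded_point:
  "t \<le> k \<Longrightarrow> c \<in> cubes (graded_nilspace t A) n \<Longrightarrow> v \<in> discrete_cube n \<Longrightarrow>
    c v \<in> points (graded_nilspace t A)"
  by (auto simp: cubes_graded_iff)

lemma cubes_graded_degree_cube:
  "t \<le> k \<Longrightarrow> c \<in> cubes (graded_nilspace t A) n \<Longrightarrow> i \<in> {1..t} \<Longrightarrow> degree_cube (A i) i n (\<lambda>v. c v i)"
  by (auto simp: cubes_graded_iff)

lemma restrict_point:
  "t \<le> k \<Longrightarrow> x \<in> points (graded_nilspace k A) \<Longrightarrow> restrict x {1..t} \<in> points (graded_nilspace t A)"
  by (auto simp: points_graded_nilspace)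

lemma restrict_cube:
  assumes t: "t \<le> k" and c: "c \<in> cubes (graded_nilspace k A) n"
  shows "(\<lambda>v\<in>discrete_cube n. restrict (c v) {1..t}) \<in> cubes (graded_nilspace t A) n"
  using t by (rule cubes_graded_restrictI) (use cubes_graded_degree_cube[OF _ c] t in auto)

text \<open>A section of the restriction to the first \<open>t\<close> coordinates; through it a map
  on the full product induces one on the partial product.\<close>

definition pad :: "nat \<Rightarrow> (nat \<Rightarrow> 'a) \<Rightarrow> nat \<Rightarrow> 'a" where
  "pad t y = (\<lambda>i\<in>{1..k}. if i \<le> t then y i else \<one>\<^bsub>A i\<^esub>)"

lemma pad_point:
  "t \<le> k \<Longrightarrow> y \<in> points (graded_nilspace t A) \<Longrightarrow> pad t y \<in> points (graded_nilspace k A)"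
  by (auto simp: points_graded_nilspace pad_def group_one_closed)

lemma restrict_pad:
  assumes "t \<le> k" "y \<in> points (graded_nilspace t A)"
  shows "restrict (pad t y) {1..t} = y"
  using assms by (intro ext) (auto simp: points_graded_nilspace pad_def PiE_def extensional_def)

text \<open>The coordinates that are filled in are constant, and constant maps are cubes of every
  degree.\<close>

lemma pad_cube:
  assumes t: "t \<le> k" and c: "c \<in> cubes (graded_nilspace t A) n"
  shows "(\<lambda>v\<in>discrete_cube n. pad t (c v)) \<in> cubes (graded_nilspace k A) n"
  unfolding pad_def
proof (rule cubes_graded_restrictI)
  fix i assume i: "i \<in> {1..k}"
  then interpret comm_group "A i" using comm_groups by auto
  show "degree_cube (A i) i n (\<lambda>v. if i \<le> t then c v i else \<one>\<^bsub>A i\<^esub>)"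
    using cubes_graded_degree_cube[OF t c, of i] degree_cube_const[of "\<one>\<^bsub>A i\<^esub>"] i
    by (cases "i \<le> t") auto
qed simp

lemma comp_cube:
  assumes c: "c \<in> cubes (graded_nilspace k A) n" and \<phi>: "\<phi> \<in> cube_morphisms m n"
  shows "(\<lambda>v\<in>discrete_cube m. c (\<phi> v)) \<in> cubes (graded_nilspace k A) m"
  unfolding cubes_graded_iff[OF order_refl]
proof (intro conjI ballI)
  show "(\<lambda>v\<in>discrete_cube m. c (\<phi> v)) \<in> discrete_cube m \<rightarrow>\<^sub>E points (graded_nilspace k A)"
    using cubes_graded_point[OF _ c] cube_morphism_in_cube[OF \<phi>] by auto
  fix i assume i: "i \<in> {1..k}"
  then interpret comm_group "A i" using comm_groups by auto
  show "degree_cube (A i) i m (\<lambda>v. (\<lambda>v\<in>discrete_cube m. c (\<phi> v)) v i)"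
    by (rule degree_cube_cong[OF degree_cube_comp[OF cubes_graded_degree_cube[OF _ c i] \<phi>]]) simp_all
qed

lemma const_cube:
  assumes x: "x \<in> points (graded_nilspace k A)"
  shows "(\<lambda>v\<in>discrete_cube n. x) \<in> cubes (graded_nilspace k A) n"
  unfolding cubes_graded_iff[OF order_refl]
proof (intro conjI ballI)
  fix i assume i: "i \<in> {1..k}"
  then interpret comm_group "A i" using comm_groups by auto
  show "degree_cube (A i) i n (\<lambda>v. (\<lambda>v\<in>discrete_cube n. x) v i)"
    by (rule degree_cube_cong[OF degree_cube_const[of "x i"]])
      (use x i in \<open>auto simp: points_graded_nilspace\<close>)
qed (use x in auto)

end

section \<open>Shift maps: they are translations and determine their tuple\<close>

locale graded_shift = graded_groups +
  fixes s :: nat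
  assumes height: "s \<in> {1..k}"
begin

definition shift_tuples :: "(nat \<Rightarrow> (nat \<Rightarrow> 'a) \<Rightarrow> 'a) set" where
  "shift_tuples =
    (\<Pi>\<^sub>E i\<in>{s..k}. nilspace_hom (graded_nilspace (i - s) A) (degree_nilspace (i - s) (A i)))"

text \<open>For \<open>i = s\<close> the restriction of \<open>x\<close> to the empty index set is
  the only point of the empty product, so \<open>T s\<close> amounts to an element of
  \<open>A s\<close>.\<close>

definition shift_map :: "(nat \<Rightarrow> (nat \<Rightarrow> 'a) \<Rightarrow> 'a) \<Rightarrow> (nat \<Rightarrow> 'a) \<Rightarrow> nat \<Rightarrow> 'a" where
  "shift_map T = (\<lambda>x\<in>points (graded_nilspace k A). \<lambda>i\<in>{1..k}.
     x i \<otimes>\<^bsub>A i\<^esub> (if i < s then \<one>\<^bsub>A i\<^esub> else T i (restrict x {1..i - s})))"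

lemma shift_tuple_hom:
  "T \<in> shift_tuples \<Longrightarrow> s \<le> i \<Longrightarrow> i \<le> k \<Longrightarrow>
    T i \<in> nilspace_hom (graded_nilspace (i - s) A) (degree_nilspace (i - s) (A i))"
  by (auto simp: shift_tuples_def PiE_def Pi_def)

lemma shift_tuple_in_carrier:
  assumes "T \<in> shift_tuples" "s \<le> i" "i \<le> k" "x \<in> points (graded_nilspace k A)"
  shows "T i (restrict x {1..i - s}) \<in> carrier (A i)"
  using assms by (intro nilspace_hom_in_carrier[OF shift_tuple_hom] restrict_point) auto

text \<open>Along a cube the increment in coordinate \<open>i\<close> has degree
  \<open>i - s\<close>; cutting it off outside a face of codimension \<open>s\<close> brings it to
  degree \<open>i\<close>, so its product with the original coordinate is still a cube of degree
  \<open>i\<close>.\<close>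

lemma shift_map_translation:
  assumes T: "T \<in> shift_tuples"
  shows "shift_map T \<in> height_translations s (graded_nilspace k A)"
  unfolding height_translations_def
proof (intro CollectI conjI allI ballI)
  have "shift_map T x \<in> points (graded_nilspace k A)" if x: "x \<in> points (graded_nilspace k A)" for x
  proof -
    have "x i \<otimes>\<^bsub>A i\<^esub> (if i < s then \<one>\<^bsub>A i\<^esub> else T i (restrict x {1..i - s})) \<in> carrier (A i)"
      if i: "i \<in> {1..k}" for i
    proof -
      interpret comm_group "A i" using comm_groups i by auto
      show ?thesis
        using i graded_point_coord[OF x i] shift_tuple_in_carrier[OF T _ _ x, of i] by auto
    qed
    then show ?thesis using x by (simp add: shift_map_def) (simp add: points_graded_nilspace)
  qed
  moreover have "shift_map T \<in> extensional (points (graded_nilspace k A))"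
    by (simp add: shift_map_def)
  ultimately show "shift_map T \<in> points (graded_nilspace k A) \<rightarrow>\<^sub>E points (graded_nilspace k A)"
    by (simp add: PiE_def)
  fix n c F
  assume c: "c \<in> cubes (graded_nilspace k A) n" and "F \<in> cube_faces n s"
  then obtain J w where J: "J \<subseteq> {1..n}" "card J = s"
    and F: "F = {v \<in> discrete_cube n. \<forall>j\<in>J. v j = w j}"
    by (auto simp: cube_faces_def)
  have x: "c v \<in> points (graded_nilspace k A)" if "v \<in> discrete_cube n" for v
    using cubes_graded_point[OF _ c that] by simp
  \<comment> \<open>The factor by which the modified map differs from \<open>c\<close>: trivial off
    \<open>F\<close> and in the coordinates below \<open>s\<close>. Writing the modified map as a
    product makes closure under multiplication applicable.\<close>
  let ?d = "\<lambda>v i. if s \<le> i \<and> v \<in> F then T i (restrict (c v) {1..i - s}) else \<one>\<^bsub>A i\<^esub>"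
  have "(\<lambda>v\<in>discrete_cube n. \<lambda>i\<in>{1..k}. c v i \<otimes>\<^bsub>A i\<^esub> ?d v i) \<in> cubes (graded_nilspace k A) n"
  proof (rule cubes_graded_restrictI)
    fix i assume i: "i \<in> {1..k}"
    then interpret comm_group "A i" using comm_groups by auto
    have "degree_cube (A i) i n (\<lambda>v. ?d v i)"
    proof (cases "s \<le> i")
      case True
      have "degree_cube (A i) (i - s) n (\<lambda>v. T i ((\<lambda>v\<in>discrete_cube n. restrict (c v) {1..i - s}) v))"
        using True i by (intro nilspace_hom_degree_cube[OF shift_tuple_hom[OF T]] restrict_cube c) auto
      then have "degree_cube (A i) (i - s + card J) n (\<lambda>v. if \<forall>j\<in>J. v j = w j
          then T i ((\<lambda>v\<in>discrete_cube n. restrict (c v) {1..i - s}) v) else \<one>\<^bsub>A i\<^esub>)"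
        using J(1) finite_subset by (intro degree_cube_on_face) auto
      then have "degree_cube (A i) (i - s + card J) n (\<lambda>v. ?d v i)"
        by (rule degree_cube_cong) (use True in \<open>auto simp: F\<close>)
      then show ?thesis using True J(2) by simp
    qed (use degree_cube_const in simp)
    then show "degree_cube (A i) i n (\<lambda>v. c v i \<otimes>\<^bsub>A i\<^esub> ?d v i)"
      using cubes_graded_degree_cube[OF _ c i] by (intro degree_cube_mult) auto
  qed simp
  also have "(\<lambda>v\<in>discrete_cube n. \<lambda>i\<in>{1..k}. c v i \<otimes>\<^bsub>A i\<^esub> ?d v i) =
      (\<lambda>v\<in>discrete_cube n. if v \<in> F then shift_map T (c v) else c v)"
  proof (rule restrict_ext)
    fix v assume v: "v \<in> discrete_cube n"
    show "(\<lambda>i\<in>{1..k}. c v i \<otimes>\<^bsub>A i\<^esub> ?d v i) = (if v \<in> F then shift_map T (c v) else c v)"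
    proof (cases "v \<in> F")
      case True
      then show ?thesis using x[OF v] by (auto simp: shift_map_def intro!: restrict_ext)
    next
      case False
      have "c v i \<otimes>\<^bsub>A i\<^esub> ?d v i = c v i" if i: "i \<in> {1..k}" for i
      proof -
        interpret comm_group "A i" using comm_groups i by auto
        show ?thesis using graded_point_coord[OF x[OF v] i] False by simp
      qed
      then have "(\<lambda>i\<in>{1..k}. c v i \<otimes>\<^bsub>A i\<^esub> ?d v i) = restrict (c v) {1..k}"
        by (rule restrict_ext)
      also have "\<dots> = c v"
        using x[OF v] by (simp add: points_graded_nilspace PiE_restrict)
      finally show ?thesis using False by simp
    qed
  qed
  finally show "(\<lambda>v\<in>discrete_cube n. if v \<in> F then shift_map T (c v) else c v)
      \<in> cubes (graded_nilspace k A) n" .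
qed

text \<open>Every point \<open>y\<close> of the domain of \<open>T i\<close> is the restriction of
  its padding, so evaluating both shift maps there and cancelling coordinate \<open>i\<close> of the
  padded point compares \<open>T i y\<close> with \<open>T' i y\<close>.\<close>

lemma inj_on_shift_map: "inj_on shift_map shift_tuples"
proof (rule inj_onI)
  fix T T' assume T: "T \<in> shift_tuples" and T': "T' \<in> shift_tuples" and eq: "shift_map T = shift_map T'"
  show "T = T'"
  proof (rule PiE_ext[OF T[unfolded shift_tuples_def] T'[unfolded shift_tuples_def]])
    fix i assume i: "i \<in> {s..k}"
    then have ik: "i \<in> {1..k}" using height by auto
    then interpret comm_group "A i" using comm_groups by auto
    have hom: "T i \<in> points (graded_nilspace (i - s) A) \<rightarrow>\<^sub>E points (degree_nilspace (i - s) (A i))"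
      "T' i \<in> points (graded_nilspace (i - s) A) \<rightarrow>\<^sub>E points (degree_nilspace (i - s) (A i))"
      using shift_tuple_hom[OF T, of i] shift_tuple_hom[OF T', of i] i by (auto simp: nilspace_hom_def)
    show "T i = T' i"
    proof (rule PiE_ext[OF hom])
      fix y assume y: "y \<in> points (graded_nilspace (i - s) A)"
      have t: "i - s \<le> k" using i by auto
      let ?x = "pad (i - s) y"
      have x: "?x \<in> points (graded_nilspace k A)" using pad_point[OF t y] .
      have "?x i \<otimes>\<^bsub>A i\<^esub> T i y = ?x i \<otimes>\<^bsub>A i\<^esub> T' i y"
        using fun_cong[OF fun_cong[OF eq, of ?x], of i] x i ik restrict_pad[OF t y]
        by (simp add: shift_map_def)
      moreover have "?x i \<in> carrier (A i)" using graded_point_coord[OF x ik] .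
      ultimately show "T i y = T' i y"
        using PiE_mem[OF hom(1) y] PiE_mem[OF hom(2) y] by (simp add: points_degree_nilspace)
    qed
  qed
qed

section \<open>Displacements of a translation and surjectivity\<close>

definition displacement :: "((nat \<Rightarrow> 'a) \<Rightarrow> nat \<Rightarrow> 'a) \<Rightarrow> nat \<Rightarrow> (nat \<Rightarrow> 'a) \<Rightarrow> 'a" where
  "displacement \<alpha> i x = inv\<^bsub>A i\<^esub> (x i) \<otimes>\<^bsub>A i\<^esub> \<alpha> x i"

context
  fixes \<alpha>
  assumes \<alpha>: "\<alpha> \<in> height_translations s (graded_nilspace k A)"
begin

lemma translation_point:
  "x \<in> points (graded_nilspace k A) \<Longrightarrow> \<alpha> x \<in> points (graded_nilspace k A)"
  using \<alpha> by (auto simp: height_translations_def)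

lemma displacement_closed:
  assumes "i \<in> {1..k}" "x \<in> points (graded_nilspace k A)"
  shows "displacement \<alpha> i x \<in> carrier (A i)"
proof -
  interpret comm_group "A i" using comm_groups assms by auto
  show ?thesis
    using graded_point_coord[OF assms(2,1)] graded_point_coord[OF translation_point[OF assms(2)] assms(1)]
    by (simp add: displacement_def)
qed

lemma displacement_on_face:
  assumes i: "i \<in> {1..k}" and c: "c \<in> cubes (graded_nilspace k A) n" and F: "F \<in> cube_faces n s"
  shows "degree_cube (A i) i n (\<lambda>v. if v \<in> F then displacement \<alpha> i (c v) else \<one>\<^bsub>A i\<^esub>)"
proof -
  interpret comm_group "A i" using comm_groups i by auto
  let ?c = "\<lambda>v\<in>discrete_cube n. if v \<in> F then \<alpha> (c v) else c v"
  have "?c \<in> cubes (graded_nilspace k A) n"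
    using \<alpha> c F by (auto simp: height_translations_def)
  then have "degree_cube (A i) i n (\<lambda>v. inv\<^bsub>A i\<^esub> (c v i) \<otimes>\<^bsub>A i\<^esub> ?c v i)"
    using i c by (intro degree_cube_mult degree_cube_inv cubes_graded_degree_cube[OF order_refl])
  then show ?thesis
  proof (rule degree_cube_cong)
    fix v assume v: "v \<in> discrete_cube n"
    have "c v i \<in> carrier (A i)"
      using graded_point_coord[OF cubes_graded_point[OF order_refl c v] i] .
    then show "inv\<^bsub>A i\<^esub> (c v i) \<otimes>\<^bsub>A i\<^esub> ?c v i = (if v \<in> F then displacement \<alpha> i (c v) else \<one>\<^bsub>A i\<^esub>)"
      using v by (simp add: displacement_def)
  qed
qed

text \<open>The face where the last \<open>s\<close> coordinates are 1 has the shape that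
  \<open>degree_cube_from_face\<close> peels off; for \<open>m = 0\<close> it is the top vertex
  alone.\<close>

lemma displacement_on_top_face:
  assumes i: "i \<in> {1..k}" and c: "c \<in> cubes (graded_nilspace k A) (m + s)"
  shows "degree_cube (A i) i (m + s)
    (\<lambda>v. if \<forall>j\<in>{m+1..m+s}. v j = 1 then displacement \<alpha> i (c v) else \<one>\<^bsub>A i\<^esub>)"
proof -
  interpret comm_group "A i" using comm_groups i by auto
  let ?w = "\<lambda>j\<in>{1..m+s}. 1 :: nat"
  have "?w \<in> discrete_cube (m + s)" by (rule restrict_in_discrete_cube) simp
  then have "{v \<in> discrete_cube (m + s). \<forall>j\<in>{m+1..m+s}. v j = ?w j} \<in> cube_faces (m + s) s"
    unfolding cube_faces_def by (intro CollectI exI[of _ "{m+1..m+s}"] exI[of _ ?w]) auto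
  from displacement_on_face[OF i c this] show ?thesis
    by (rule degree_cube_cong) auto
qed

text \<open>On the constant cube of dimension \<open>s\<close>, a face of codimension
  \<open>s\<close> is a single vertex. Since \<open>i \<le> s - 1\<close>, the cut-off displacement
  has degree \<open>s - 1\<close> in dimension \<open>s\<close>, and such a cube cannot deviate from
  a constant at the top vertex only.\<close>

lemma displacement_low:
  assumes i: "i \<in> {1..k}" "i < s" and x: "x \<in> points (graded_nilspace k A)"
  shows "displacement \<alpha> i x = \<one>\<^bsub>A i\<^esub>"
proof -
  interpret comm_group "A i" using comm_groups i by auto
  \<comment> \<open>Matches dimension \<open>s\<close> with degree \<open>s - 1\<close>, the pairing
    that \<open>degree_cube_two_values\<close> asks for.\<close>
  have s: "s = Suc (s - 1)" using i by simp
  have c: "(\<lambda>v\<in>discrete_cube (0 + s). x) \<in> cubes (graded_nilspace k A) (0 + s)"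
    using x by (rule const_cube)
  have "degree_cube (A i) i (0 + s)
      (\<lambda>v. if \<forall>j\<in>{0+1..0+s}. v j = 1 then displacement \<alpha> i x else \<one>\<^bsub>A i\<^esub>)"
    by (rule degree_cube_cong[OF displacement_on_top_face[OF i(1) c]]) simp
  then have "degree_cube (A i) (s - 1) s (\<lambda>v. if \<forall>j\<in>{1..s}. v j = 1 then displacement \<alpha> i x else \<one>\<^bsub>A i\<^esub>)"
    using i degree_cube_mono[of i s _ "s - 1"] by simp
  then have "degree_cube (A i) (s - 1) (Suc (s - 1))
      (\<lambda>v. if \<forall>j\<in>{1..Suc (s - 1)}. v j = 1 then displacement \<alpha> i x else \<one>\<^bsub>A i\<^esub>)"
    by (simp only: s[symmetric])
  then show ?thesis
    using displacement_closed[OF i(1) x] by (intro degree_cube_two_values[symmetric]) auto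
qed

text \<open>Pull \<open>c\<close> back along the projection that forgets \<open>s\<close> extra coordinates and move the face where
  these coordinates are 1.\<close>

lemma displacement_degree_cube:
  assumes i: "s \<le> i" "i \<le> k" and c: "c \<in> cubes (graded_nilspace k A) m"
  shows "degree_cube (A i) (i - s) m (\<lambda>v. displacement \<alpha> i (c v))"
proof -
  have ik: "i \<in> {1..k}" using i height by auto
  interpret comm_group "A i" using comm_groups ik by auto
  define \<pi> where "\<pi> = (\<lambda>v\<in>discrete_cube (m + s). \<lambda>j\<in>{1..m}. v j :: nat)"
  have "\<pi> \<in> cube_morphisms (m + s) m"
    unfolding \<pi>_def by (rule cube_morphism_restrictI) (auto intro: coord_function_proj)
  from displacement_on_top_face[OF ik comp_cube[OF c this]]
  have "degree_cube (A i) (i - s + s) (m + s)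
      (\<lambda>v. if \<forall>j\<in>{m+1..m+s}. v j = 1 then displacement \<alpha> i (c (restrict v {1..m})) else \<one>\<^bsub>A i\<^esub>)"
    unfolding le_add_diff_inverse2[OF i(1)] by (rule degree_cube_cong) (simp add: \<pi>_def)
  moreover have "displacement \<alpha> i (c v) \<in> carrier (A i)" if "v \<in> discrete_cube m" for v
    using displacement_closed[OF ik] cubes_graded_point[OF _ c that] by simp
  ultimately show ?thesis by (rule_tac degree_cube_from_face)
qed

text \<open>The map \<open>?c\<close> below is constant in the coordinates up to \<open>t\<close>; in the coordinates \<open>j > t\<close>
  every map on the \<open>(t + 1)\<close>-dimensional cube is a cube.\<close>

lemma displacement_eq:
  assumes i: "s \<le> i" "i \<le> k" and x: "x \<in> points (graded_nilspace k A)" and y: "y \<in> points (graded_nilspace k A)"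
    and eq: "\<And>j. j \<in> {1..i - s} \<Longrightarrow> x j = y j"
  shows "displacement \<alpha> i x = displacement \<alpha> i y"
proof -
  have ik: "i \<in> {1..k}" using i height by auto
  interpret Ai: comm_group "A i" using comm_groups ik by auto
  define t where "t = i - s"
  let ?top = "\<lambda>v. \<forall>j\<in>{1..Suc t}. v j = (1 :: nat)"
  let ?c = "\<lambda>v\<in>discrete_cube (Suc t). if ?top v then y else x"
  have "?c \<in> cubes (graded_nilspace k A) (Suc t)"
    unfolding cubes_graded_iff[OF order_refl]
  proof (intro conjI ballI)
    fix j assume j: "j \<in> {1..k}"
    then interpret comm_group "A j" using comm_groups by auto
    have xy: "x j \<in> carrier (A j)" "y j \<in> carrier (A j)"
      using graded_point_coord[OF x j] graded_point_coord[OF y j] .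
    show "degree_cube (A j) j (Suc t) (\<lambda>v. ?c v j)"
    proof (cases "j \<le> t")
      case True
      then have "x j = y j" using eq j by (auto simp: t_def)
      then show ?thesis by (intro degree_cube_cong[OF degree_cube_const[OF xy(1)]]) auto
    next
      case False
      then show ?thesis using xy by (intro degree_cube_low_dim) auto
    qed
  qed (use x y in auto)
  from displacement_degree_cube[OF i this]
  have "degree_cube (A i) t (Suc t) (\<lambda>v. if ?top v then displacement \<alpha> i y else displacement \<alpha> i x)"
    unfolding t_def by (rule Ai.degree_cube_cong) auto
  then show ?thesis
    using displacement_closed[OF ik x] displacement_closed[OF ik y] by (intro Ai.degree_cube_two_values)
qed

text \<open>A cube of the partial product pads to a cube of the full product, along which the
  displacement has degree \<open>i - s\<close>.\<close>

lemma displacement_hom: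
  assumes i: "s \<le> i" "i \<le> k"
  shows "(\<lambda>y\<in>points (graded_nilspace (i - s) A). displacement \<alpha> i (pad (i - s) y)) \<in>
    nilspace_hom (graded_nilspace (i - s) A) (degree_nilspace (i - s) (A i))"
    (is "?f \<in> _")
  unfolding nilspace_hom_def
proof (intro CollectI conjI allI ballI)
  have ik: "i \<in> {1..k}" and t: "i - s \<le> k" using i height by auto
  interpret comm_group "A i" using comm_groups ik by auto
  show f: "?f \<in> points (graded_nilspace (i - s) A) \<rightarrow>\<^sub>E points (degree_nilspace (i - s) (A i))"
    using displacement_closed[OF ik pad_point[OF t]] by (auto simp: points_degree_nilspace)
  fix n c assume c: "c \<in> cubes (graded_nilspace (i - s) A) n"
  have cv: "c v \<in> points (graded_nilspace (i - s) A)" if "v \<in> discrete_cube n" for v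
    using cubes_graded_point[OF t c that] .
  show "compose (discrete_cube n) ?f c \<in> cubes (degree_nilspace (i - s) (A i)) n"
  \<comment> \<open>The cubes of \<open>degree_nilspace 0\<close> are literally the constant maps.
    Here the domain has only one point, so the composite is constant whatever the displacement
    is.\<close>
  proof (cases "i - s = 0")
    case True
    have "(\<lambda>_. undefined) \<in> points (graded_nilspace (i - s) A)"
      by (simp add: True points_graded_nilspace)
    then have "?f (\<lambda>_. undefined) \<in> carrier (A i)"
      using f by (auto simp: points_degree_nilspace)
    moreover have "compose (discrete_cube n) ?f c = (\<lambda>v\<in>discrete_cube n. ?f (\<lambda>_. undefined))"
      unfolding compose_def
    proof (rule restrict_ext)
      fix v assume "v \<in> discrete_cube n"
      then have "c v = (\<lambda>_. undefined)" using cv by (simp add: True points_graded_nilspace)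
      then show "?f (c v) = ?f (\<lambda>_. undefined)" by simp
    qed
    ultimately show ?thesis using True by (auto simp: degree_nilspace_def)
  next
    case False
    have "degree_cube (A i) (i - s) n (\<lambda>v. displacement \<alpha> i ((\<lambda>v\<in>discrete_cube n. pad (i - s) (c v)) v))"
      using displacement_degree_cube[OF i pad_cube[OF t c]] .
    then have "degree_cube (A i) (i - s) n (compose (discrete_cube n) ?f c)"
      by (rule degree_cube_cong) (simp add: compose_def cv)
    then show ?thesis using False cubes_degree_nilspace by (simp add: compose_def)
  qed
qed

lemma translation_eq_shift_map: "\<exists>T\<in>shift_tuples. \<alpha> = shift_map T"
proof -
  define T where "T = (\<lambda>i\<in>{s..k}. \<lambda>y\<in>points (graded_nilspace (i - s) A). displacement \<alpha> i (pad (i - s) y))"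
  have "T \<in> shift_tuples"
    unfolding shift_tuples_def T_def using displacement_hom by auto
  moreover have "\<alpha> = shift_map T"
  proof
    fix x
    show "\<alpha> x = shift_map T x"
    proof (cases "x \<in> points (graded_nilspace k A)")
      case True
      note x = True
      have "\<alpha> x = (\<lambda>i\<in>{1..k}. \<alpha> x i)"
        using translation_point[OF x] by (simp add: points_graded_nilspace PiE_restrict)
      also have "\<dots> = (\<lambda>i\<in>{1..k}. x i \<otimes>\<^bsub>A i\<^esub> (if i < s then \<one>\<^bsub>A i\<^esub> else T i (restrict x {1..i - s})))"
      proof (rule restrict_ext)
        fix i assume i: "i \<in> {1..k}"
        then interpret comm_group "A i" using comm_groups by auto
        have cl: "x i \<in> carrier (A i)" "\<alpha> x i \<in> carrier (A i)"
          using graded_point_coord[OF x i] graded_point_coord[OF translation_point[OF x] i] .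
        have "displacement \<alpha> i x = (if i < s then \<one>\<^bsub>A i\<^esub> else T i (restrict x {1..i - s}))"
        proof (cases "i < s")
          case True
          then show ?thesis using displacement_low[OF i True x] by simp
        next
          case False
          have t: "i - s \<le> k" using i by auto
          have r: "restrict x {1..i - s} \<in> points (graded_nilspace (i - s) A)"
            using restrict_point[OF t x] .
          \<comment> \<open>Restricting and then padding alters only coordinates above
            \<open>i - s\<close>, which the displacement does not see.\<close>
          have "displacement \<alpha> i x = displacement \<alpha> i (pad (i - s) (restrict x {1..i - s}))"
            using False i t by (intro displacement_eq x pad_point r) (auto simp: pad_def)
          then show ?thesis using False i r by (simp add: T_def)
        qed
        moreover have "x i \<otimes>\<^bsub>A i\<^esub> displacement \<alpha> i x = \<alpha> x i"
          using cl by (simp add: displacement_def m_assoc[symmetric])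
        ultimately show "\<alpha> x i = x i \<otimes>\<^bsub>A i\<^esub> (if i < s then \<one>\<^bsub>A i\<^esub> else T i (restrict x {1..i - s}))"
          by simp
      qed
      finally show ?thesis using x by (simp add: shift_map_def)
    next
      case False
      \<comment> \<open>Outside the points of the product both maps are \<open>undefined\<close>,
        being extensional.\<close>
      then show ?thesis using \<alpha> by (auto simp: shift_map_def height_translations_def PiE_def extensional_def)
    qed
  qed
  ultimately show ?thesis by blast
qed

end

lemma bij_betw_shift_map:
  "bij_betw shift_map shift_tuples (height_translations s (graded_nilspace k A))"
  using inj_on_shift_map shift_map_translation translation_eq_shift_map
  by (intro bij_betw_imageI) blast+

end

theorem theorem3p15:
  fixes A :: "nat \<Rightarrow> ('a, 'b) monoid_scheme" and k s :: nat
  assumes "\<And>i. i \<in> {1..k} \<Longrightarrow> comm_group (A i)"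
    and "s \<in> {1..k}"
  shows "bij_betw
    (\<lambda>T. \<lambda>x\<in>points (graded_nilspace k A). \<lambda>i\<in>{1..k}.
       x i \<otimes>\<^bsub>A i\<^esub> (if i < s then \<one>\<^bsub>A i\<^esub> else T i (restrict x {1..i - s})))
    (\<Pi>\<^sub>E i\<in>{s..k}. nilspace_hom (graded_nilspace (i - s) A) (degree_nilspace (i - s) (A i)))
    (height_translations s (graded_nilspace k A))"
proof -
  interpret graded_shift A k s
    by (intro graded_shift.intro graded_groups.intro graded_shift_axioms.intro) (use assms in auto)
  show ?thesis
    using bij_betw_shift_map unfolding shift_map_def shift_tuples_def .
qed

end
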